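(* Let $h:\mathbf{C}\to\mathbf{C}$ be a topologically mixing homeomorphism of the Cantor space such that for every pair of nonempty open sets $U,V\subseteq\mathbf{C}$ there exist a compact set $K_{U,V}\subseteq\mathbf{C}$ and $m(U,V)\in\mathbb{N}$ with: $K_{U,V}$ is nowhere dense in $\mathbf{C}$ and $h(K_{U,V})=K_{U,V}$; and $h^m(K_{U,V}\cap U)\cap V\ne\emptyset$ for all $m\ge m(U,V)$. Then there exist $\Phi$ such that $\mathbf{F}_\Phi$ is a Lelek fence and a lifting $\hat h$ of $h$ to $\mathbf{F}_\Phi$ which is a topologically mixing homeomorphism.
   Context: For $\Phi=(\varphi^L,\varphi^U)$ with $\varphi^L,\varphi^U:\mathbf{C}\to[0,1]$, $\varphi^L$ lower semicontinuous, $\varphi^U$ upper semicontinuous, $\varphi^L\le\varphi^U$, the fence is $\mathbf{F}_\Phi=\{(x,t)\in\mathbf{C}\times[0,1]:\varphi^L(x)\le t\le\varphi^U(x)\}$ and $\mathbf{F}_\Phi(x)=\{t:(x,t)\in\mathbf{F}_\Phi\}$. $\mathbf{F}_\Phi$ is a Lelek fence if $\varphi^L\equiv0$, $\varphi^U$ is positive on a dense subset of $\mathbf{C}$, and the graph $\{(x,\varphi^U(x)):x\in\mathbf{C}\}$ is dense in $\mathbf{F}_\Phi$. A map $\hat h:\mathbf{F}_\Phi\to\mathbf{F}_\Phi$ is a lifting of $h$ if $\hat h(x,t)=(h(x),s)$ with $s\in\mathbf{F}_\Phi(h(x))$ for all $(x,t)\in\mathbf{F}_\Phi$. *)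

theory Defs
  imports "HOL-Analysis.Analysis"
begin

text \<open>The Cantor space is modelled as the type nat \<Rightarrow> bool with the product
  topology (bool discrete); the whole space is UNIV.\<close>

type_synonym cantor = "nat \<Rightarrow> bool"

definition lower_semicont :: "('a::topological_space \<Rightarrow> real) \<Rightarrow> bool" where
  "lower_semicont f \<longleftrightarrow> (\<forall>x c. c < f x \<longrightarrow> eventually (\<lambda>y. c < f y) (nhds x))"

definition upper_semicont :: "('a::topological_space \<Rightarrow> real) \<Rightarrow> bool" where
  "upper_semicont f \<longleftrightarrow> (\<forall>x c. f x < c \<longrightarrow> eventually (\<lambda>y. f y < c) (nhds x))"

definition admissible :: "(cantor \<Rightarrow> real) \<Rightarrow> (cantor \<Rightarrow> real) \<Rightarrow> bool" where
  "admissible phiL phiU \<longleftrightarrow>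
     (\<forall>x. 0 \<le> phiL x \<and> phiL x \<le> 1 \<and> 0 \<le> phiU x \<and> phiU x \<le> 1) \<and>
     lower_semicont phiL \<and> upper_semicont phiU \<and> (\<forall>x. phiL x \<le> phiU x)"

definition fence :: "(cantor \<Rightarrow> real) \<Rightarrow> (cantor \<Rightarrow> real) \<Rightarrow> (cantor \<times> real) set" where
  "fence phiL phiU = {(x, t). phiL x \<le> t \<and> t \<le> phiU x}"

definition lelek_fence :: "(cantor \<Rightarrow> real) \<Rightarrow> (cantor \<Rightarrow> real) \<Rightarrow> bool" where
  "lelek_fence phiL phiU \<longleftrightarrow>
     (\<forall>x. phiL x = 0) \<and>
     (\<exists>D. closure D = UNIV \<and> (\<forall>x\<in>D. 0 < phiU x)) \<and>
     fence phiL phiU \<subseteq> closure {(x, phiU x) | x. True}"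

definition top_mixing_on :: "'a::topological_space set \<Rightarrow> ('a \<Rightarrow> 'a) \<Rightarrow> bool" where
  "top_mixing_on S f \<longleftrightarrow>
     (\<forall>U V. openin (top_of_set S) U \<and> openin (top_of_set S) V \<and> U \<noteq> {} \<and> V \<noteq> {} \<longrightarrow>
        (\<exists>N. \<forall>n\<ge>N. (f ^^ n) ` U \<inter> V \<noteq> {}))"

definition nowhere_dense :: "'a::topological_space set \<Rightarrow> bool" where
  "nowhere_dense K \<longleftrightarrow> interior (closure K) = {}"

definition lifting :: "(cantor \<Rightarrow> real) \<Rightarrow> (cantor \<Rightarrow> real) \<Rightarrow> (cantor \<Rightarrow> cantor)
    \<Rightarrow> (cantor \<times> real \<Rightarrow> cantor \<times> real) \<Rightarrow> bool" where
  "lifting phiL phiU h hh \<longleftrightarrow>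
     (\<forall>p\<in>fence phiL phiU. fst (hh p) = h (fst p) \<and> hh p \<in> fence phiL phiU)"

end

theory Submission
  imports Defs
begin

text \<open>
  The fence lies under \<open>\<phi> = inf\<^sub>n exp w\<^sub>n\<close> for a decreasing sequence of continuous functions
  \<open>w\<^sub>n \<le> 0\<close> whose increments \<open>v\<^sub>n\<close> satisfy \<open>\<bar>v\<^sub>n \<circ> h - v\<^sub>n\<bar> \<le> 2\<^bsup>-n\<^esup>\<close>. Then
  \<open>u = lim (w\<^sub>n \<circ> h - w\<^sub>n)\<close> exists uniformly, \<open>\<phi> \<circ> h = exp u \<cdot> \<phi>\<close>, and
  \<open>(x, t) \<mapsto> (h x, exp (u x) \<cdot> t)\<close> is a lifting that maps the graph of \<open>\<phi>\<close> onto itself.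
  It therefore suffices that this map is mixing on the graph and that the graph is dense.

  Each step serves one task: cylinders \<open>U\<close>, \<open>V\<close> and target intervals for \<open>log \<phi>\<close> on them. Pick
  \<open>p \<in> U\<close> and \<open>q \<in> V\<close> outside the nowhere dense invariant set \<open>L\<close> used so far and such that
  \<open>q\<close> is not on a long orbit segment around \<open>p\<close>. Small clopen neighbourhoods \<open>A\<close> of \<open>p\<close> and \<open>B\<close>
  of \<open>q\<close> are then far apart in time, so a slowly varying \<open>v\<^sub>n\<close> can push the values on \<open>A\<close> and \<open>B\<close>
  independently into the target intervals while vanishing on \<open>L\<close>. Adding \<open>K\<^sub>A\<^sub>,\<^sub>B\<close> to \<open>L\<close> freezes
  these values on the orbits in \<open>K\<^sub>A\<^sub>,\<^sub>B\<close> that go from \<open>A\<close> to \<open>B\<close>, which exist for all large times.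
\<close>

section \<open>Topology of the Cantor space: cylinders, separation, nowhere dense sets\<close>

definition cylinder :: "bool list \<Rightarrow> cantor set" where
  "cylinder l = {y. \<forall>i<length l. y i = l ! i}"

lemma cylinder_eq: "cylinder l = (\<Inter>i<length l. {y. y i = l ! i})"
  by (auto simp: cylinder_def)

lemma coordinate_clopen: "open {y::cantor. y i \<in> S}" "closed {y::cantor. y i \<in> S}"
proof -
  have "open ((\<lambda>y::cantor. y i) -` T)" for T
    by (rule open_vimage) (auto intro: open_discrete)
  from this[of S] this[of "- S"] show "open {y::cantor. y i \<in> S}" "closed {y::cantor. y i \<in> S}"
    by (auto simp: vimage_def closed_def Collect_neg_eq[symmetric])
qed

lemma open_cylinder: "open (cylinder l)"
proof -
  have "open {y::cantor. y i = l ! i}" for i using coordinate_clopen(1)[of i "{l ! i}"] by simp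
  then show ?thesis unfolding cylinder_eq by (intro open_INT) auto
qed

lemma closed_cylinder: "closed (cylinder l)"
proof -
  have "closed {y::cantor. y i = l ! i}" for i using coordinate_clopen(2)[of i "{l ! i}"] by simp
  then show ?thesis unfolding cylinder_eq by (intro closed_INT) auto
qed

lemma cylinder_base:
  assumes "open U" "x \<in> U"
  obtains l where "x \<in> cylinder l" "cylinder l \<subseteq> U"
proof -
  have "openin (product_topology (\<lambda>i. euclidean) UNIV) U"
    using assms(1) by (simp add: open_fun_def)
  from product_topology_open_contains_basis[OF this assms(2)]
  obtain X where X: "x \<in> PiE UNIV X" "finite {i. X i \<noteq> UNIV}" "PiE UNIV X \<subseteq> U"
    by auto
  obtain n where n: "\<And>i. X i \<noteq> UNIV \<Longrightarrow> i < n"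
    using finite_nat_set_iff_bounded X(2) by auto
  show ?thesis
  proof
    show "x \<in> cylinder (map x [0..<n])" by (auto simp: cylinder_def)
    show "cylinder (map x [0..<n]) \<subseteq> U"
    proof
      fix y assume y: "y \<in> cylinder (map x [0..<n])"
      have "y i \<in> X i" for i
      proof (cases "i < n")
        case True
        then have "y i = x i" using y by (simp add: cylinder_def)
        then show ?thesis using X(1) by (auto simp: PiE_def)
      next
        case False
        then show ?thesis using n[of i] by auto
      qed
      then show "y \<in> U" using X(3) by (auto simp: PiE_def)
    qed
  qed
qed

text \<open>Flipping one coordinate beyond those fixed by a cylinder inside \<open>U\<close> already
  gives infinitely many points.\<close>

lemma infinite_open_cantor:
  fixes U :: "cantor set"
  assumes "open U" "U \<noteq> {}"
  shows "infinite U"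
proof -
  obtain x where "x \<in> U" using assms(2) by auto
  with assms(1) obtain l where l: "x \<in> cylinder l" "cylinder l \<subseteq> U"
    using cylinder_base by blast
  define f where "f k = (\<lambda>i. if i = length l + k then \<not> x i else x i)" for k
  have "inj f"
  proof
    fix j k assume "f j = f k"
    then have "f j (length l + j) = f k (length l + j)" by simp
    then show "j = k" by (auto simp: f_def split: if_splits)
  qed
  moreover have "range f \<subseteq> U" using l by (auto simp: f_def cylinder_def)
  ultimately show ?thesis using finite_subset range_inj_infinite by blast
qed

lemma cantor_separate_points:
  fixes p q :: cantor
  assumes "p \<noteq> q"
  obtains A B where "open A" "open B" "p \<in> A" "q \<in> B" "A \<inter> B = {}"
proof -
  obtain i where "p i \<noteq> q i" using assms by auto
  show ?thesis
  proof
    show "open {y::cantor. y i \<in> {p i}}" "open {y::cantor. y i \<in> {q i}}"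
      by (rule coordinate_clopen)+
  qed (use \<open>p i \<noteq> q i\<close> in auto)
qed

lemma compact_imp_closed_cantor:
  fixes K :: "cantor set"
  assumes "compact K"
  shows "closed K"
proof -
  have "Hausdorff_space (euclidean :: cantor topology)"
    unfolding Hausdorff_space_def disjnt_def
    using cantor_separate_points by (metis open_openin)
  then show ?thesis
    using compactin_imp_closedin[of euclidean K] assms by simp
qed

lemma continuous_on_indicator_clopen:
  fixes A :: "'a::topological_space set"
  assumes "open A" "closed A"
  shows "continuous_on UNIV (indicator A :: 'a \<Rightarrow> real)"
proof -
  have "continuous_on (A \<union> - A) (indicator A :: 'a \<Rightarrow> real)"
  proof (rule continuous_on_open_Un)
    show "continuous_on A (indicator A :: 'a \<Rightarrow> real)"
      by (rule continuous_on_eq[of _ "\<lambda>_. 1"]) auto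
    show "continuous_on (- A) (indicator A :: 'a \<Rightarrow> real)"
      by (rule continuous_on_eq[of _ "\<lambda>_. 0"]) auto
  qed (use assms in auto)
  then show ?thesis by simp
qed

lemma nowhere_dense_Un_closed:
  assumes "closed K" "closed L" "nowhere_dense K" "nowhere_dense L"
  shows "nowhere_dense (K \<union> L)"
  using assms interior_closed_Un_empty_interior[of K L]
  by (simp add: nowhere_dense_def closure_closed)

section \<open>Orbit distance and functions that vary slowly along orbits\<close>

locale invertible_map =
  fixes h g :: "'a::topological_space \<Rightarrow> 'a"
  assumes cont_h: "continuous_on UNIV h" and cont_g: "continuous_on UNIV g"
    and gh [simp]: "g (h x) = x" and hg [simp]: "h (g x) = x"
begin

text \<open>One step along orbits in both time directions; the preimage of \<open>A\<close> under
  \<open>g\<close> is its image under \<open>h\<close>. Hence \<open>(thicken ^^ n) A\<close> is the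
  union of the translates of \<open>A\<close> by the powers of \<open>h\<close> with exponents from
  \<open>-n\<close> to \<open>n\<close>.\<close>

definition thicken :: "'a set \<Rightarrow> 'a set" where
  "thicken A = A \<union> h -` A \<union> g -` A"

lemma mem_thicken: "x \<in> thicken A \<longleftrightarrow> x \<in> A \<or> h x \<in> A \<or> g x \<in> A"
  by (auto simp: thicken_def)

text \<open>Being at most one step apart on an orbit is a symmetric relation.\<close>

lemma thicken_disjoint_iff: "thicken A \<inter> B = {} \<longleftrightarrow> A \<inter> thicken B = {}"
proof -
  have "A \<inter> thicken B = {}" if "thicken A \<inter> B = {}" for A B
  proof -
    have "x \<notin> thicken B" if "x \<in> A" for x
    proof -
      have "x \<in> thicken A" "h x \<in> thicken A" "g x \<in> thicken A"
        using that by (auto simp: thicken_def)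
      then have "x \<notin> B" "h x \<notin> B" "g x \<notin> B"
        using \<open>thicken A \<inter> B = {}\<close> by blast+
      then show ?thesis by (simp add: thicken_def)
    qed
    then show ?thesis by auto
  qed
  from this[of A B] this[of B A] show ?thesis by (metis Int_commute)
qed

lemma thicken_pow_disjoint_iff:
  "(thicken ^^ n) A \<inter> B = {} \<longleftrightarrow> A \<inter> (thicken ^^ n) B = {}"
proof (induction n arbitrary: B)
  case (Suc n)
  have "(thicken ^^ Suc n) A \<inter> B = {} \<longleftrightarrow> (thicken ^^ n) A \<inter> thicken B = {}"
    by (simp add: thicken_disjoint_iff)
  also have "\<dots> \<longleftrightarrow> A \<inter> (thicken ^^ Suc n) B = {}"
    by (simp add: Suc funpow_swap1)
  finally show ?case .
qed simp

lemma thicken_pow_mono: "m \<le> n \<Longrightarrow> (thicken ^^ m) A \<subseteq> (thicken ^^ n) A"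
  by (rule lift_Suc_mono_le[of "\<lambda>n. (thicken ^^ n) A"]) (auto simp: thicken_def)

lemma thicken_pow_mono_set: "A \<subseteq> B \<Longrightarrow> (thicken ^^ n) A \<subseteq> (thicken ^^ n) B"
  by (induction n) (auto simp: thicken_def)

text \<open>Combined with \<open>thicken_pow_disjoint_iff\<close>, this shows that a set missing an
  invariant \<open>L\<close> still misses it after any number of thickenings.\<close>

lemma thicken_pow_invariant: "h ` L = L \<Longrightarrow> (thicken ^^ n) L = L"
proof (induction n)
  case (Suc n)
  have "g x \<in> L \<Longrightarrow> x \<in> L" for x using Suc.prems hg by (metis imageI)
  moreover have "h x \<in> L \<Longrightarrow> x \<in> L" for x using Suc.prems gh by (metis imageE)
  ultimately have "thicken L = L" unfolding thicken_def by blast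
  then show ?case using Suc by simp
qed simp

lemma clopen_thicken_pow:
  assumes "open A" "closed A"
  shows "open ((thicken ^^ n) A) \<and> closed ((thicken ^^ n) A)"
proof (induction n)
  case (Suc n)
  then show ?case
    using cont_h cont_g
    by (simp add: thicken_def open_Un closed_Un open_vimage closed_vimage)
qed (use assms in simp)

lemma finite_thicken_pow: "finite A \<Longrightarrow> finite ((thicken ^^ n) A)"
proof (induction n)
  case (Suc n)
  have "inj h" "inj g" using gh hg by (metis injI)+
  then show ?case using Suc by (auto simp: thicken_def intro!: finite_vimageI)
qed simp

text \<open>The thickenings are nested, so this is \<open>n\<close> minus the orbit distance from
  \<open>x\<close> to \<open>A\<close>, cut off at 0: a tent of height \<open>n\<close> and slope at
  most 1 along orbits.\<close>

definition depth :: "nat \<Rightarrow> 'a set \<Rightarrow> 'a \<Rightarrow> real" where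
  "depth n A x = (\<Sum>k<n. indicator ((thicken ^^ k) A) x)"

lemma depth_nonneg: "0 \<le> depth n A x"
  by (simp add: depth_def sum_nonneg)

lemma continuous_depth:
  assumes "open A" "closed A"
  shows "continuous_on UNIV (depth n A)"
  unfolding depth_def[abs_def]
  by (intro continuous_on_sum continuous_on_indicator_clopen)
    (use clopen_thicken_pow[OF assms] in auto)

lemma depth_on: "x \<in> A \<Longrightarrow> depth n A x = n"
  using thicken_pow_mono[of 0 _ A] by (simp add: depth_def subset_iff)

lemma depth_off: "x \<notin> (thicken ^^ n) A \<Longrightarrow> depth n A x = 0"
  unfolding depth_def
proof (intro sum.neutral ballI)
  fix k assume "x \<notin> (thicken ^^ n) A" "k \<in> {..<n}"
  then show "indicator ((thicken ^^ k) A) x = (0::real)"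
    using thicken_pow_mono[of k n A] by (auto simp: indicator_def)
qed

lemma depth_slow: "\<bar>depth n A (h x) - depth n A x\<bar> \<le> 1"
proof -
  have *: "depth n A y \<le> depth n A x + 1"
    if "\<And>k. y \<in> (thicken ^^ k) A \<Longrightarrow> x \<in> (thicken ^^ Suc k) A" for x y
  proof -
    \<comment> \<open>Moving from \<open>y\<close> to \<open>x\<close> shifts the index by one, and
      only the top term \<open>k = n\<close> of the shifted sum is not counted by
      \<open>depth n A x\<close>.\<close>
    have "depth n A y \<le> (\<Sum>k<n. indicator ((thicken ^^ Suc k) A) x)"
      unfolding depth_def using that by (intro sum_mono) (auto simp: indicator_def)
    also have "\<dots> \<le> (\<Sum>k<Suc n. indicator ((thicken ^^ k) A) x)"
      unfolding sum.lessThan_Suc_shift by simp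
    also have "\<dots> \<le> depth n A x + 1"
      unfolding depth_def by (auto simp: indicator_def)
    finally show ?thesis .
  qed
  from *[of "h x" x] *[of x "h x"] show ?thesis by (auto simp: thicken_def)
qed

end

section \<open>Adjusting a weight function to meet one task\<close>

locale invertible_cantor_map = invertible_map h g for h g :: "cantor \<Rightarrow> cantor"
begin

text \<open>By induction, \<open>p\<close> is separated from each of \<open>q\<close>,
  \<open>h q\<close> and \<open>g q\<close> with one thickening fewer; the neighbourhoods of the
  latter two are pulled back to \<open>q\<close>.\<close>

lemma thicken_pow_separate:
  assumes "q \<notin> (thicken ^^ n) {p}"
  shows "\<exists>A B. open A \<and> open B \<and> p \<in> A \<and> q \<in> B \<and> (thicken ^^ n) A \<inter> B = {}"
  using assms
proof (induction n arbitrary: q)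
  case 0
  then have "p \<noteq> q" by auto
  then show ?case using cantor_separate_points[of p q] by (metis funpow_0)
next
  case (Suc n)
  let ?T = "thicken ^^ n"
  from Suc.prems have "q \<notin> ?T {p}" "h q \<notin> ?T {p}" "g q \<notin> ?T {p}"
    by (simp_all add: mem_thicken)
  then obtain A1 B1 A2 B2 A3 B3 where
    1: "open A1" "open B1" "p \<in> A1" "q \<in> B1" "?T A1 \<inter> B1 = {}" and
    2: "open A2" "open B2" "p \<in> A2" "h q \<in> B2" "?T A2 \<inter> B2 = {}" and
    3: "open A3" "open B3" "p \<in> A3" "g q \<in> B3" "?T A3 \<inter> B3 = {}"
    using Suc.IH[of q] Suc.IH[of "h q"] Suc.IH[of "g q"] by metis
  define A where "A = A1 \<inter> A2 \<inter> A3"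
  define B where "B = B1 \<inter> h -` B2 \<inter> g -` B3"
  have "?T A \<subseteq> ?T A1" "?T A \<subseteq> ?T A2" "?T A \<subseteq> ?T A3"
    unfolding A_def by (intro thicken_pow_mono_set; blast)+
  then have "thicken (?T A) \<inter> B = {}"
    using 1(5) 2(5) 3(5) unfolding thicken_def B_def by blast
  moreover have "open A" "open B"
    using 1 2 3 cont_h cont_g by (auto simp: A_def B_def intro!: open_Int open_vimage)
  moreover have "p \<in> A" "q \<in> B" using 1 2 3 by (auto simp: A_def B_def)
  ultimately show ?case by (intro exI[of _ A] exI[of _ B]) simp
qed

text \<open>Weights may only decrease. The shift lowers \<open>w p\<close> to the midpoint of the
  target interval if it lies above, and is 0 otherwise; the strict inequalities then persist near
  \<open>p\<close>.\<close>

lemma target_neighbourhood: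
  fixes w :: "cantor \<Rightarrow> real"
  assumes "continuous_on UNIV w" "open W" "p \<in> W" "a < b"
  shows "\<exists>A. open A \<and> p \<in> A \<and> A \<subseteq> W \<and>
    (\<forall>x\<in>A. w x + min 0 ((a + b) / 2 - w p) < b \<and>
      (a < w p \<longrightarrow> a < w x + min 0 ((a + b) / 2 - w p)))"
proof -
  define \<alpha> where "\<alpha> = min 0 ((a + b) / 2 - w p)"
  define S where "S = (if a < w p then {a - \<alpha><..<b - \<alpha>} else {..<b - \<alpha>})"
  have "open (w -` S)"
    using assms(1) by (intro open_vimage) (auto simp: S_def)
  moreover have "w p \<in> S"
    using \<open>a < b\<close> by (auto simp: S_def \<alpha>_def min_def field_simps)
  ultimately show ?thesis
    using assms(2,3) unfolding \<alpha>_def[symmetric]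
    by (intro exI[of _ "W \<inter> w -` S"]) (auto simp: S_def open_Int split: if_splits)
qed

text \<open>Where possible, \<open>U\<close> is first cut down to the open set where
  \<open>w\<close> exceeds \<open>a\<close>. Removing a closed nowhere dense set from a nonempty
  open set leaves a nonempty open, hence infinite, set.\<close>

lemma generic_target_point:
  fixes w :: "cantor \<Rightarrow> real"
  assumes "continuous_on UNIV w" "closed L" "nowhere_dense L" "open U" "U \<noteq> {}" "finite F"
  obtains p where "p \<in> U" "p \<notin> L" "p \<notin> F" "\<exists>x\<in>U. a < w x \<Longrightarrow> a < w p"
proof -
  define U' where "U' = (if \<exists>x\<in>U. a < w x then U \<inter> w -` {a<..} else U)"
  have "open U'" "U' \<noteq> {}"
    using assms by (auto simp: U'_def intro!: open_Int open_vimage)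
  have "\<not> U' \<subseteq> L"
    using \<open>open U'\<close> \<open>U' \<noteq> {}\<close> assms(2,3) interior_maximal[of U' L]
    by (auto simp: nowhere_dense_def closure_closed)
  then have "infinite (U' - L)"
    using \<open>open U'\<close> assms(2) by (intro infinite_open_cantor) auto
  then obtain p where "p \<in> U' - L" "p \<notin> F"
    using assms(6) by (meson finite_subset subsetI)
  then show ?thesis using that[of p] by (auto simp: U'_def split: if_splits)
qed

text \<open>The upper bounds \<open>b\<close> and \<open>d\<close> can always be enforced by
  lowering \<open>w\<close>. The lower bounds \<open>a\<close> and \<open>c\<close> are demanded
  only if \<open>w\<close> exceeds them somewhere on the open set in question.\<close>

lemma refine_step:
  fixes w :: "cantor \<Rightarrow> real"
  assumes K: "\<And>U V. open U \<Longrightarrow> open V \<Longrightarrow> U \<noteq> {} \<Longrightarrow> V \<noteq> {} \<Longrightarrow>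
      \<exists>K m0. compact K \<and> nowhere_dense K \<and> h ` K = K \<and>
        (\<forall>m\<ge>m0. (h ^^ m) ` (K \<inter> U) \<inter> V \<noteq> {})"
    and w: "continuous_on UNIV w" "\<And>x. w x \<le> 0"
    and L: "closed L" "nowhere_dense L" "h ` L = L"
    and U: "open U" "U \<noteq> {}" and V: "open V" "V \<noteq> {}"
    and ab: "a < b" and cd: "c < d" and "\<eta> > 0"
  shows "\<exists>w' L' m0. continuous_on UNIV w' \<and> (\<forall>x. w' x \<le> w x) \<and> (\<forall>x\<in>L. w' x = w x) \<and>
      (\<forall>x. \<bar>(w' (h x) - w (h x)) - (w' x - w x)\<bar> \<le> \<eta>) \<and>
      closed L' \<and> nowhere_dense L' \<and> h ` L' = L' \<and> L \<subseteq> L' \<and>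
      (\<forall>m\<ge>m0. \<exists>x\<in>L' \<inter> U. (h ^^ m) x \<in> L' \<inter> V \<and>
        w' x < b \<and> ((\<exists>y\<in>U. a < w y) \<longrightarrow> a < w' x) \<and>
        w' ((h ^^ m) x) < d \<and> ((\<exists>y\<in>V. c < w y) \<longrightarrow> c < w' ((h ^^ m) x)))"
proof -
  define e1 where "e1 = (a + b) / 2"
  define e2 where "e2 = (c + d) / 2"
  \<comment> \<open>Tents of heights up to \<open>\<bar>e1\<bar>\<close> and
    \<open>\<bar>e2\<bar>\<close> spread over \<open>N\<close> steps have total slope at most
    \<open>\<eta>\<close>; \<open>Suc\<close> makes \<open>N\<close> positive.\<close>
  define N where "N = Suc (nat \<lceil>(\<bar>e1\<bar> + \<bar>e2\<bar>) / \<eta>\<rceil>)"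
  have "(\<bar>e1\<bar> + \<bar>e2\<bar>) / \<eta> \<le> N" unfolding N_def by linarith
  then have N: "(\<bar>e1\<bar> + \<bar>e2\<bar>) / N \<le> \<eta>"
    using \<open>\<eta> > 0\<close> by (simp add: N_def field_simps del: of_nat_Suc)
  have "N > 0" by (simp add: N_def)
  obtain p where p: "p \<in> U" "p \<notin> L" "\<exists>x\<in>U. a < w x \<Longrightarrow> a < w p"
    using generic_target_point[OF w(1) L(1,2) U, of "{}" a] by auto
  obtain q where q: "q \<in> V" "q \<notin> L" "q \<notin> (thicken ^^ N) {p}" "\<exists>x\<in>V. c < w x \<Longrightarrow> c < w q"
    using generic_target_point[OF w(1) L(1,2) V finite_thicken_pow, of "{p}" N c] by auto
  define \<alpha> where "\<alpha> = min 0 (e1 - w p)"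
  define \<gamma> where "\<gamma> = min 0 (e2 - w q)"
  \<comment> \<open>As \<open>w \<le> 0\<close>, the shifts are bounded independently of
    \<open>p\<close> and \<open>q\<close>. This lets \<open>N\<close> be fixed first, as the choice
    of \<open>q\<close> requires.\<close>
  have \<alpha>: "\<alpha> \<le> 0" "\<bar>\<alpha>\<bar> \<le> \<bar>e1\<bar>" using w(2)[of p] by (auto simp: \<alpha>_def)
  have \<gamma>: "\<gamma> \<le> 0" "\<bar>\<gamma>\<bar> \<le> \<bar>e2\<bar>" using w(2)[of q] by (auto simp: \<gamma>_def)
  obtain A0 B0 where sep: "open A0" "open B0" "p \<in> A0" "q \<in> B0" "(thicken ^^ N) A0 \<inter> B0 = {}"
    using thicken_pow_separate[OF q(3)] by auto
  have "open (A0 \<inter> U - L)" "p \<in> A0 \<inter> U - L" "open (B0 \<inter> V - L)" "q \<in> B0 \<inter> V - L"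
    using sep U V L p q by auto
  from target_neighbourhood[OF w(1) this(1,2) ab] target_neighbourhood[OF w(1) this(3,4) cd]
  obtain A1 B1 where
    A1: "open A1" "p \<in> A1" "A1 \<subseteq> A0 \<inter> U - L" "\<And>x. x \<in> A1 \<Longrightarrow> w x + \<alpha> < b"
      "\<And>x. x \<in> A1 \<Longrightarrow> a < w p \<Longrightarrow> a < w x + \<alpha>" and
    B1: "open B1" "q \<in> B1" "B1 \<subseteq> B0 \<inter> V - L" "\<And>x. x \<in> B1 \<Longrightarrow> w x + \<gamma> < d"
      "\<And>x. x \<in> B1 \<Longrightarrow> c < w q \<Longrightarrow> c < w x + \<gamma>"
    unfolding \<alpha>_def \<gamma>_def e1_def e2_def by blast
  obtain la where la: "p \<in> cylinder la" "cylinder la \<subseteq> A1" using cylinder_base A1(1,2) .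
  obtain lb where lb: "q \<in> cylinder lb" "cylinder lb \<subseteq> B1" using cylinder_base B1(1,2) .
  define A where "A = cylinder la"
  define B where "B = cylinder lb"
  have clopen: "open A" "closed A" "open B" "closed B"
    by (auto simp: A_def B_def open_cylinder closed_cylinder)
  have AB: "(thicken ^^ N) A \<inter> B = {}"
    using thicken_pow_mono_set[of A A0 N] sep(5) la(2) lb(2) A1(3) B1(3)
    unfolding A_def B_def by blast
  have BA: "(thicken ^^ N) B \<inter> A = {}"
    using AB thicken_pow_disjoint_iff[of N A B] by blast
  have AL: "(thicken ^^ N) A \<inter> L = {}" and BL: "(thicken ^^ N) B \<inter> L = {}"
    unfolding thicken_pow_disjoint_iff thicken_pow_invariant[OF L(3)]
    using la(2) lb(2) A1(3) B1(3) unfolding A_def B_def by blast+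
  \<comment> \<open>Each tent vanishes on the core of the other, so \<open>v\<close> is exactly
    \<open>\<alpha>\<close> on \<open>A\<close> and \<open>\<gamma>\<close> on \<open>B\<close>.
    Elsewhere the tents may overlap, so their slopes are added.\<close>
  define v where "v x = \<alpha> / N * depth N A x + \<gamma> / N * depth N B x" for x
  have v_cont: "continuous_on UNIV v"
    unfolding v_def[abs_def] using clopen by (intro continuous_intros continuous_depth)
  have v_nonpos: "v x \<le> 0" for x
    unfolding v_def using \<alpha>(1) \<gamma>(1) depth_nonneg[of N A x] depth_nonneg[of N B x]
    by (intro add_nonpos_nonpos mult_nonpos_nonneg divide_nonpos_nonneg) auto
  have v_L: "v x = 0" if "x \<in> L" for x
  proof -
    have "x \<notin> (thicken ^^ N) A" "x \<notin> (thicken ^^ N) B" using that AL BL by blast+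
    then show ?thesis by (simp add: v_def depth_off)
  qed
  have v_A: "v x = \<alpha>" if "x \<in> A" for x
    using that BA depth_off[of x N B] depth_on[of x A N] \<open>N > 0\<close> by (auto simp: v_def)
  have v_B: "v x = \<gamma>" if "x \<in> B" for x
    using that AB depth_off[of x N A] depth_on[of x B N] \<open>N > 0\<close> by (auto simp: v_def)
  have v_slow: "\<bar>v (h x) - v x\<bar> \<le> \<eta>" for x
  proof -
    have "v (h x) - v x = \<alpha> / N * (depth N A (h x) - depth N A x)
        + \<gamma> / N * (depth N B (h x) - depth N B x)"
      by (simp add: v_def algebra_simps)
    also have "\<bar>\<dots>\<bar> \<le> \<bar>\<alpha> / N\<bar> * 1 + \<bar>\<gamma> / N\<bar> * 1"
      by (intro order_trans[OF abs_triangle_ineq] add_mono;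
          unfold abs_mult; intro mult_left_mono depth_slow abs_ge_zero)
    also have "\<dots> \<le> (\<bar>e1\<bar> + \<bar>e2\<bar>) / N"
      using \<alpha>(2) \<gamma>(2) by (simp add: add_divide_distrib add_mono divide_right_mono)
    finally show ?thesis using N by linarith
  qed
  obtain C m0 where C: "compact C" "nowhere_dense C" "h ` C = C"
    "\<And>m. m \<ge> m0 \<Longrightarrow> (h ^^ m) ` (C \<inter> A) \<inter> B \<noteq> {}"
    using K[of A B] clopen la(1) lb(1) unfolding A_def B_def by blast
  have "closed C" using compact_imp_closed_cantor C(1) .
  have inv: "(h ^^ m) x \<in> C" if "x \<in> C" for m x
    using that C(3) by (induction m) auto
  show ?thesis
  proof (intro exI conjI allI ballI impI)
    show "continuous_on UNIV (\<lambda>x. w x + v x)"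
      using w(1) v_cont by (intro continuous_intros)
    show "closed (L \<union> C)" "nowhere_dense (L \<union> C)" "h ` (L \<union> C) = L \<union> C" "L \<subseteq> L \<union> C"
      using L C \<open>closed C\<close> by (auto simp: image_Un intro!: nowhere_dense_Un_closed)
    fix m assume "m0 \<le> m"
    then obtain x where x: "x \<in> C" "x \<in> A" "(h ^^ m) x \<in> B"
      using C(4) by blast
    have "x \<in> A1" "(h ^^ m) x \<in> B1" using x la lb by (auto simp: A_def B_def)
    then show "\<exists>x\<in>(L \<union> C) \<inter> U. (h ^^ m) x \<in> (L \<union> C) \<inter> V \<and>
        w x + v x < b \<and> ((\<exists>y\<in>U. a < w y) \<longrightarrow> a < w x + v x) \<and>
        w ((h ^^ m) x) + v ((h ^^ m) x) < d \<and>
        ((\<exists>y\<in>V. c < w y) \<longrightarrow> c < w ((h ^^ m) x) + v ((h ^^ m) x))"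
      using x inv[of x m] A1(3-5) B1(3-5) p(3) q(4) v_A[of x] v_B[of "(h ^^ m) x"]
      by (intro bexI[of _ x]) auto
  qed (use v_nonpos v_L v_slow in auto)
qed

end

section \<open>Meeting all tasks along a decreasing sequence of weights\<close>

locale slow_tower = invertible_cantor_map h g for h g :: "cantor \<Rightarrow> cantor" +
  fixes w :: "nat \<Rightarrow> cantor \<Rightarrow> real" and L :: "nat \<Rightarrow> cantor set"
  assumes w_0: "w 0 x = 0"
    and w_cont: "continuous_on UNIV (w n)"
    and w_Suc: "w (Suc n) x \<le> w n x"
    and L_Suc: "L n \<subseteq> L (Suc n)"
    and w_Suc_L: "x \<in> L n \<Longrightarrow> w (Suc n) x = w n x"
    and w_slow: "\<bar>(w (Suc n) (h x) - w n (h x)) - (w (Suc n) x - w n x)\<bar> \<le> (1/2) ^ n"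
    and w_targets: "\<And>k l (a::rat) (b::rat) (c::rat) (d::rat). a < b \<Longrightarrow> c < d \<Longrightarrow>
      \<exists>n m0. \<forall>m\<ge>m0. \<exists>x\<in>L n \<inter> cylinder k. (h ^^ m) x \<in> L n \<inter> cylinder l \<and>
        w n x < of_rat b \<and> ((\<exists>y\<in>cylinder k. \<forall>i. of_rat a < w i y) \<longrightarrow> of_rat a < w n x) \<and>
        w n ((h ^^ m) x) < of_rat d \<and>
        ((\<exists>y\<in>cylinder l. \<forall>i. of_rat c < w i y) \<longrightarrow> of_rat c < w n ((h ^^ m) x))"

context invertible_cantor_map
begin

text \<open>Two cylinders and four rational bounds make a task, so there are countably many tasks,
  and stage \<open>n\<close> treats \<open>from_nat n\<close>. The limit needs lower bounds only
  when some point exceeds them at every stage, which in particular gives the condition at the stage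
  concerned.\<close>

lemma refine_sequence:
  assumes K: "\<And>U V. open U \<Longrightarrow> open V \<Longrightarrow> U \<noteq> {} \<Longrightarrow> V \<noteq> {} \<Longrightarrow>
      \<exists>K m0. compact K \<and> nowhere_dense K \<and> h ` K = K \<and>
        (\<forall>m\<ge>m0. (h ^^ m) ` (K \<inter> U) \<inter> V \<noteq> {})"
  shows "\<exists>w L. slow_tower h g w L"
proof -
  \<comment> \<open>Invariant of the stages; its last clause records that the weights start at
    0.\<close>
  define I where "I n s \<longleftrightarrow> continuous_on UNIV (fst s) \<and> (\<forall>x. fst s x \<le> 0) \<and>
      closed (snd s) \<and> nowhere_dense (snd s) \<and> h ` snd s = snd s \<and>
      (n = 0 \<longrightarrow> (\<forall>x. fst s x = 0))"
    for n :: nat and s :: "(cantor \<Rightarrow> real) \<times> cantor set"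
  define G where "G \<tau> w w' L' \<longleftrightarrow> (case \<tau> of (k, l, a, b, c, d) \<Rightarrow> a < b \<longrightarrow> c < d \<longrightarrow>
      (\<exists>m0. \<forall>m\<ge>m0. \<exists>x\<in>L' \<inter> cylinder k. (h ^^ m) x \<in> L' \<inter> cylinder l \<and>
        w' x < of_rat b \<and> ((\<exists>y\<in>cylinder k. of_rat a < w y) \<longrightarrow> of_rat a < w' x) \<and>
        w' ((h ^^ m) x) < of_rat d \<and>
        ((\<exists>y\<in>cylinder l. of_rat c < w y) \<longrightarrow> of_rat c < w' ((h ^^ m) x))))"
    for \<tau> :: "bool list \<times> bool list \<times> rat \<times> rat \<times> rat \<times> rat"
      and w w' :: "cantor \<Rightarrow> real" and L'
  define R where "R n s s' \<longleftrightarrow> (\<forall>x. fst s' x \<le> fst s x) \<and> snd s \<subseteq> snd s' \<and>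
      (\<forall>x\<in>snd s. fst s' x = fst s x) \<and>
      (\<forall>x. \<bar>(fst s' (h x) - fst s (h x)) - (fst s' x - fst s x)\<bar> \<le> (1/2) ^ n) \<and>
      G (from_nat n) (fst s) (fst s') (snd s')"
    for n and s s' :: "(cantor \<Rightarrow> real) \<times> cantor set"
  have cyl_ne: "cylinder l \<noteq> {}" for l
    by (auto simp: cylinder_def intro!: exI[of _ "\<lambda>i. l ! i"])
  have "\<exists>f. \<forall>n. I n (f n) \<and> R n (f n) (f (Suc n))"
  proof (rule dependent_nat_choice)
    show "\<exists>s. I 0 s"
      by (rule exI[of _ "(\<lambda>_. 0, {})"]) (simp add: I_def nowhere_dense_def)
    fix s n assume "I n s"
    obtain w L where s: "s = (w, L)" by (cases s)
    have w: "continuous_on UNIV w" "\<And>x. w x \<le> 0"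
      and L: "closed L" "nowhere_dense L" "h ` L = L"
      using \<open>I n s\<close> by (auto simp: I_def s)
    obtain k l a b c d where \<tau>:
      "(from_nat n :: bool list \<times> bool list \<times> rat \<times> rat \<times> rat \<times> rat) = (k, l, a, b, c, d)"
      by (metis prod.exhaust)
    show "\<exists>s'. I (Suc n) s' \<and> R n s s'"
    proof (cases "a < b \<and> c < d")
      case True
      then have ab: "(of_rat a :: real) < of_rat b" and cd: "(of_rat c :: real) < of_rat d"
        by (auto simp: of_rat_less)
      from refine_step[OF K w L open_cylinder cyl_ne open_cylinder cyl_ne ab cd,
          of "(1/2) ^ n" k l]
      obtain w' L' m0 where *: "continuous_on UNIV w'" "\<forall>x. w' x \<le> w x" "\<forall>x\<in>L. w' x = w x"
        "\<forall>x. \<bar>(w' (h x) - w (h x)) - (w' x - w x)\<bar> \<le> (1/2) ^ n"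
        "closed L'" "nowhere_dense L'" "h ` L' = L'" "L \<subseteq> L'"
        "\<forall>m\<ge>m0. \<exists>x\<in>L' \<inter> cylinder k. (h ^^ m) x \<in> L' \<inter> cylinder l \<and>
        w' x < of_rat b \<and> ((\<exists>y\<in>cylinder k. of_rat a < w y) \<longrightarrow> of_rat a < w' x) \<and>
        w' ((h ^^ m) x) < of_rat d \<and>
        ((\<exists>y\<in>cylinder l. of_rat c < w y) \<longrightarrow> of_rat c < w' ((h ^^ m) x))"
        by auto
      have "G (from_nat n) w w' L'"
        unfolding G_def \<tau> prod.case using *(9) by (intro impI exI[of _ m0])
      moreover have "\<forall>x. w' x \<le> 0" using *(2) w(2) order_trans by blast
      ultimately show ?thesis
        using * by (intro exI[of _ "(w', L')"]) (simp add: I_def R_def s)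
    next
      case False
      \<comment> \<open>A task with an empty target interval is void, so the pair is kept
        unchanged.\<close>
      then show ?thesis
        using w L by (intro exI[of _ "(w, L)"]) (auto simp: I_def R_def s G_def \<tau>)
    qed
  qed
  then obtain f where f: "\<And>n. I n (f n)" "\<And>n. R n (f n) (f (Suc n))" by auto
  have "slow_tower h g (\<lambda>n. fst (f n)) (\<lambda>n. snd (f n))"
  proof unfold_locales
    fix k l :: "bool list" and a b c d :: rat assume ab: "a < b" and cd: "c < d"
    \<comment> \<open>Stage \<open>n\<close> treats this task, so its targets are met by the weights
      with index \<open>Suc n\<close>.\<close>
    define n where "n = to_nat (k, l, a, b, c, d)"
    have "G (k, l, a, b, c, d) (fst (f n)) (fst (f (Suc n))) (snd (f (Suc n)))"
      using f(2)[of n] by (simp add: R_def n_def)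
    then obtain m0 where m0: "\<forall>m\<ge>m0. \<exists>x\<in>snd (f (Suc n)) \<inter> cylinder k.
        (h ^^ m) x \<in> snd (f (Suc n)) \<inter> cylinder l \<and>
        fst (f (Suc n)) x < of_rat b \<and>
        ((\<exists>y\<in>cylinder k. of_rat a < fst (f n) y) \<longrightarrow> of_rat a < fst (f (Suc n)) x) \<and>
        fst (f (Suc n)) ((h ^^ m) x) < of_rat d \<and>
        ((\<exists>y\<in>cylinder l. of_rat c < fst (f n) y) \<longrightarrow>
          of_rat c < fst (f (Suc n)) ((h ^^ m) x))"
      unfolding G_def prod.case using ab cd by blast
    show "\<exists>n m0. \<forall>m\<ge>m0. \<exists>x\<in>snd (f n) \<inter> cylinder k. (h ^^ m) x \<in> snd (f n) \<inter> cylinder l \<and>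
        fst (f n) x < of_rat b \<and>
        ((\<exists>y\<in>cylinder k. \<forall>i. of_rat a < fst (f i) y) \<longrightarrow> of_rat a < fst (f n) x) \<and>
        fst (f n) ((h ^^ m) x) < of_rat d \<and>
        ((\<exists>y\<in>cylinder l. \<forall>i. of_rat c < fst (f i) y) \<longrightarrow> of_rat c < fst (f n) ((h ^^ m) x))"
    proof (rule exI[of _ "Suc n"], rule exI[of _ m0], intro allI impI)
      fix m assume "m0 \<le> m"
      with m0 obtain x where x: "x \<in> snd (f (Suc n)) \<inter> cylinder k"
        "(h ^^ m) x \<in> snd (f (Suc n)) \<inter> cylinder l"
        "fst (f (Suc n)) x < of_rat b"
        "(\<exists>y\<in>cylinder k. of_rat a < fst (f n) y) \<Longrightarrow> of_rat a < fst (f (Suc n)) x"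
        "fst (f (Suc n)) ((h ^^ m) x) < of_rat d"
        "(\<exists>y\<in>cylinder l. of_rat c < fst (f n) y) \<Longrightarrow>
          of_rat c < fst (f (Suc n)) ((h ^^ m) x)" by blast
      then show "\<exists>x\<in>snd (f (Suc n)) \<inter> cylinder k. (h ^^ m) x \<in> snd (f (Suc n)) \<inter> cylinder l \<and>
        fst (f (Suc n)) x < of_rat b \<and>
        ((\<exists>y\<in>cylinder k. \<forall>i. of_rat a < fst (f i) y) \<longrightarrow> of_rat a < fst (f (Suc n)) x) \<and>
        fst (f (Suc n)) ((h ^^ m) x) < of_rat d \<and>
        ((\<exists>y\<in>cylinder l. \<forall>i. of_rat c < fst (f i) y) \<longrightarrow>
          of_rat c < fst (f (Suc n)) ((h ^^ m) x))"
        by blast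
    qed
  qed (use f in \<open>auto simp: I_def R_def\<close>)
  then show ?thesis by blast
qed

end

section \<open>The limit function, its fence and the lifting\<close>

context slow_tower
begin

text \<open>The value 0 occurs exactly where the weights tend to minus infinity.\<close>

definition phi :: "cantor \<Rightarrow> real" where
  "phi x = (INF n. exp (w n x))"

text \<open>The series telescopes to the limit of \<open>w n (h x) - w n x\<close>, which is finite
  even where \<open>phi\<close> vanishes.\<close>

definition u :: "cantor \<Rightarrow> real" where
  "u x = (\<Sum>n. (w (Suc n) (h x) - w n (h x)) - (w (Suc n) x - w n x))"

definition hh :: "cantor \<times> real \<Rightarrow> cantor \<times> real" where
  "hh p = (h (fst p), exp (u (fst p)) * snd p)"

abbreviation F :: "(cantor \<times> real) set" where
  "F \<equiv> fence (\<lambda>_. 0) phi"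

lemma w_stable:
  assumes "x \<in> L n" "n \<le> k"
  shows "w k x = w n x"
proof -
  have "x \<in> L k \<and> w k x = w n x"
    using assms(2,1) by (induction k rule: dec_induct) (use L_Suc w_Suc_L in auto)
  then show ?thesis ..
qed

lemma phi_le: "phi x \<le> exp (w n x)"
  unfolding phi_def by (intro cINF_lower bdd_belowI[of _ 0]) auto

lemma phi_lim: "(\<lambda>n. exp (w n x)) \<longlonglongrightarrow> phi x"
  unfolding phi_def
  by (intro LIMSEQ_decseq_INF bdd_belowI[of _ 0] decseq_SucI) (auto simp: w_Suc)

lemma phi_nonneg: "0 \<le> phi x"
  by (rule LIMSEQ_le_const[OF phi_lim]) auto

lemma phi_le_1: "phi x \<le> 1"
  using phi_le[of x 0] by (simp add: w_0)

text \<open>On \<open>L n\<close> the weights are frozen from stage \<open>n\<close> on; in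
  particular \<open>phi\<close> is positive there.\<close>

lemma phi_on_L:
  assumes "x \<in> L n"
  shows "phi x = exp (w n x)"
proof (rule LIMSEQ_unique[OF phi_lim])
  have "eventually (\<lambda>k. exp (w k x) = exp (w n x)) sequentially"
    using eventually_ge_at_top[of n] by (rule eventually_mono) (metis w_stable[OF assms])
  then show "(\<lambda>k. exp (w k x)) \<longlonglongrightarrow> exp (w n x)"
    by (rule tendsto_eventually)
qed

lemma upper_semicont_phi: "upper_semicont phi"
  unfolding upper_semicont_def
proof (intro allI impI)
  fix x c assume "phi x < c"
  then have "eventually (\<lambda>n. exp (w n x) < c) sequentially"
    by (rule order_tendstoD(2)[OF phi_lim])
  then obtain n where n: "exp (w n x) < c" by (auto simp: eventually_sequentially)
  have "open ((\<lambda>y. exp (w n y)) -` {..<c})"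
    by (intro open_vimage continuous_intros w_cont)
  then have "eventually (\<lambda>y. y \<in> (\<lambda>y. exp (w n y)) -` {..<c}) (nhds x)"
    using n by (intro eventually_nhds_in_open) auto
  then show "eventually (\<lambda>y. phi y < c) (nhds x)"
    by eventually_elim (use phi_le[of _ n] in \<open>auto intro: le_less_trans\<close>)
qed

text \<open>The Weierstrass M-test applies with the geometric bounds from \<open>w_slow\<close>; the
  partial sums telescope because \<open>w 0\<close> is 0.\<close>

lemma u_limit: "uniform_limit UNIV (\<lambda>n x. w n (h x) - w n x) u sequentially"
proof -
  have "(\<Sum>k<n. (w (Suc k) (h x) - w k (h x)) - (w (Suc k) x - w k x)) = w n (h x) - w n x" for n x
    by (induction n) (auto simp: w_0)
  moreover have "uniform_limit UNIV
      (\<lambda>n x. \<Sum>k<n. (w (Suc k) (h x) - w k (h x)) - (w (Suc k) x - w k x))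
      (\<lambda>x. \<Sum>k. (w (Suc k) (h x) - w k (h x)) - (w (Suc k) x - w k x)) sequentially"
    using w_slow by (intro Weierstrass_m_test[where M = "\<lambda>n. (1/2) ^ n"]) auto
  ultimately show ?thesis by (simp add: u_def[abs_def])
qed

lemma u_cont: "continuous_on UNIV u"
proof (rule uniform_limit_theorem[OF _ u_limit])
  show "eventually (\<lambda>n. continuous_on UNIV (\<lambda>x. w n (h x) - w n x)) sequentially"
    by (intro always_eventually allI continuous_intros w_cont
        continuous_on_compose2[OF w_cont cont_h]) auto
qed simp

lemma phi_h: "phi (h x) = exp (u x) * phi x"
proof (rule LIMSEQ_unique[OF phi_lim])
  have "(\<lambda>n. w n (h x) - w n x) \<longlonglongrightarrow> u x"
    using tendsto_uniform_limitI[OF u_limit] by simp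
  then have "(\<lambda>n. exp (w n (h x) - w n x) * exp (w n x)) \<longlonglongrightarrow> exp (u x) * phi x"
    by (intro tendsto_intros phi_lim)
  then show "(\<lambda>n. exp (w n (h x))) \<longlonglongrightarrow> exp (u x) * phi x"
    by (simp add: exp_add[symmetric])
qed

lemma mem_F: "(x, t) \<in> F \<longleftrightarrow> 0 \<le> t \<and> t \<le> phi x"
  by (simp add: fence_def)

lemma hh_F: "p \<in> F \<Longrightarrow> hh p \<in> F"
  by (cases p) (simp add: hh_def mem_F phi_h)

text \<open>By \<open>phi_h\<close>, each fibre is stretched by exactly the factor that carries it
  onto the fibre over \<open>h x\<close>; the inverse divides by the factor at
  \<open>g x\<close>.\<close>

lemma homeomorphism_hh:
  "homeomorphism F F hh (\<lambda>p. (g (fst p), exp (- u (g (fst p))) * snd p))"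
proof (rule homeomorphismI)
  show "continuous_on F hh"
    unfolding hh_def
    by (intro continuous_intros continuous_on_compose2[OF cont_h] continuous_on_compose2[OF u_cont]) auto
  show "continuous_on F (\<lambda>p. (g (fst p), exp (- u (g (fst p))) * snd p))"
    by (intro continuous_intros continuous_on_compose2[OF cont_g] continuous_on_compose2[OF u_cont]) auto
  show "(\<lambda>p. (g (fst p), exp (- u (g (fst p))) * snd p)) ` F \<subseteq> F"
  proof clarify
    fix x t assume "(x, t) \<in> F"
    then have t: "0 \<le> t" "t \<le> exp (u (g x)) * phi (g x)" using phi_h[of "g x"] by (auto simp: mem_F)
    then have "exp (- u (g x)) * t \<le> phi (g x)" by (simp add: exp_minus field_simps)
    then show "(g (fst (x, t)), exp (- u (g (fst (x, t)))) * snd (x, t)) \<in> F"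
      using t by (simp add: mem_F)
  qed
qed (use hh_F in \<open>auto simp: hh_def exp_minus\<close>)

lemma hh_pow_graph: "(hh ^^ m) (x, phi x) = ((h ^^ m) x, phi ((h ^^ m) x))"
  by (induction m) (auto simp: hh_def phi_h)

section \<open>Mixing on the graph and the Lelek property\<close>

lemma target_interval:
  assumes "(x, t) \<in> F" "r > 0"
  obtains a b :: rat where "a < b"
    "\<And>z. z < of_rat b \<Longrightarrow> (\<forall>i. of_rat a < w i x) \<longrightarrow> of_rat a < z \<Longrightarrow> \<bar>exp z - t\<bar> < r"
proof (cases "t = 0")
  case True
  obtain b :: rat where b: "of_rat b < ln r" using of_rat_dense[of "ln r - 1" "ln r"] by auto
  have "\<bar>exp z - t\<bar> < r" if "z < of_rat b" for z
  proof -
    have "exp z < exp (ln r)" using that b by (subst exp_less_cancel_iff) linarith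
    then show ?thesis using True \<open>r > 0\<close> by simp
  qed
  \<comment> \<open>For height 0 only the upper bound counts; \<open>b - 1\<close> is an arbitrary
    value below \<open>b\<close>.\<close>
  then show ?thesis using that[of "b - 1" b] by auto
next
  case False
  with assms have t: "0 < t" "t \<le> phi x" by (auto simp: mem_F)
  \<comment> \<open>The maximum with \<open>t / 2\<close> keeps \<open>t'\<close> positive, so that
    \<open>ln t'\<close> is meaningful even if \<open>r \<ge> t\<close>.\<close>
  define t' where "t' = max (t - r) (t / 2)"
  have t': "0 < t'" "t' < t" "t - r \<le> t'" using t \<open>r > 0\<close> by (auto simp: t'_def)
  obtain a :: rat where a: "ln t' < of_rat a" "of_rat a < ln t"
    using of_rat_dense[of "ln t'" "ln t"] t' t by auto
  obtain b :: rat where b: "ln t < of_rat b" "of_rat b < ln (t + r)"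
    using of_rat_dense[of "ln t" "ln (t + r)"] \<open>r > 0\<close> t by auto
  have "(of_rat a :: real) < of_rat b" using a b by linarith
  then have ab: "a < b" by (simp add: of_rat_less)
  have "of_rat a < w i x" for i
  proof -
    have "exp (ln t) \<le> exp (w i x)" using t phi_le[of x i] by simp
    then show ?thesis using a by (subst (asm) exp_le_cancel_iff) linarith
  qed
  moreover have "\<bar>exp z - t\<bar> < r" if "z < of_rat b" "of_rat a < z" for z
  proof -
    have "exp (ln t') < exp z" "exp z < exp (ln (t + r))"
      using that a b by (subst exp_less_cancel_iff; linarith)+
    then show ?thesis using t t' \<open>r > 0\<close> by simp
  qed
  ultimately show ?thesis using that[OF ab] by blast
qed

lemma basic_neighbourhood:
  assumes "openin (top_of_set F) U" "(x, t) \<in> U"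
  obtains l r where "r > 0" "x \<in> cylinder l"
    "\<And>y s. y \<in> cylinder l \<Longrightarrow> \<bar>s - t\<bar> < r \<Longrightarrow> (y, s) \<in> F \<Longrightarrow> (y, s) \<in> U"
proof -
  obtain T where T: "open T" "U = F \<inter> T" using assms(1) by (auto simp: openin_open)
  obtain A B where AB: "open A" "open B" "x \<in> A" "t \<in> B" "A \<times> B \<subseteq> T"
    using open_prod_elim[OF T(1), of "(x, t)"] assms(2) T(2) by (metis IntD2 mem_Sigma_iff)
  obtain l where l: "x \<in> cylinder l" "cylinder l \<subseteq> A" using cylinder_base AB(1,3) .
  obtain r where r: "r > 0" "ball t r \<subseteq> B" using AB(2,4) by (meson openE)
  show ?thesis
  proof (rule that[OF r(1) l(1)])
    fix y s assume "y \<in> cylinder l" "\<bar>s - t\<bar> < r" "(y, s) \<in> F"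
    then have "y \<in> A" "s \<in> B" using l r by (auto simp: dist_real_def subset_iff)
    then show "(y, s) \<in> U" using AB(5) \<open>(y, s) \<in> F\<close> T(2) by auto
  qed
qed

text \<open>Neighbourhoods in the fence become cylinders with intervals for the logarithm of the
  height, to which \<open>w_targets\<close> applies. The points found lie in \<open>L n\<close>, so
  their weights at stage \<open>n\<close> already give \<open>phi\<close> exactly.\<close>

lemma graph_mixing:
  assumes "openin (top_of_set F) U" "openin (top_of_set F) V" "U \<noteq> {}" "V \<noteq> {}"
  obtains N where "\<And>m. m \<ge> N \<Longrightarrow>
    \<exists>z. 0 < phi z \<and> (z, phi z) \<in> U \<and> ((h ^^ m) z, phi ((h ^^ m) z)) \<in> V"
proof -
  have UF: "U \<subseteq> F" and VF: "V \<subseteq> F" using assms openin_imp_subset by blast+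
  obtain x t y s where xt: "(x, t) \<in> U" and ys: "(y, s) \<in> V" using assms(3,4) by fast
  obtain k r where k: "r > 0" "x \<in> cylinder k"
    "\<And>y s. y \<in> cylinder k \<Longrightarrow> \<bar>s - t\<bar> < r \<Longrightarrow> (y, s) \<in> F \<Longrightarrow> (y, s) \<in> U"
    by (rule basic_neighbourhood[OF assms(1) xt]) blast
  obtain l r' where l: "r' > 0" "y \<in> cylinder l"
    "\<And>x t. x \<in> cylinder l \<Longrightarrow> \<bar>t - s\<bar> < r' \<Longrightarrow> (x, t) \<in> F \<Longrightarrow> (x, t) \<in> V"
    by (rule basic_neighbourhood[OF assms(2) ys]) blast
  obtain a b where ab: "a < b"
    "\<And>z. z < of_rat b \<Longrightarrow> (\<forall>i. of_rat a < w i x) \<longrightarrow> of_rat a < z \<Longrightarrow> \<bar>exp z - t\<bar> < r"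
    by (rule target_interval[OF subsetD[OF UF xt] k(1)]) blast
  obtain c d where cd: "c < d"
    "\<And>z. z < of_rat d \<Longrightarrow> (\<forall>i. of_rat c < w i y) \<longrightarrow> of_rat c < z \<Longrightarrow> \<bar>exp z - s\<bar> < r'"
    by (rule target_interval[OF subsetD[OF VF ys] l(1)]) blast
  obtain n N where N: "\<And>m. m \<ge> N \<Longrightarrow>
      \<exists>x\<in>L n \<inter> cylinder k. (h ^^ m) x \<in> L n \<inter> cylinder l \<and>
        w n x < of_rat b \<and> ((\<exists>y\<in>cylinder k. \<forall>i. of_rat a < w i y) \<longrightarrow> of_rat a < w n x) \<and>
        w n ((h ^^ m) x) < of_rat d \<and>
        ((\<exists>y\<in>cylinder l. \<forall>i. of_rat c < w i y) \<longrightarrow> of_rat c < w n ((h ^^ m) x))"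
    using w_targets[OF ab(1) cd(1), of k l] by metis
  show ?thesis
  proof (rule that[of N])
    fix m assume "m \<ge> N"
    from N[OF this] obtain z where z: "z \<in> L n" "z \<in> cylinder k"
      "(h ^^ m) z \<in> L n" "(h ^^ m) z \<in> cylinder l"
      "w n z < of_rat b" "(\<exists>y\<in>cylinder k. \<forall>i. of_rat a < w i y) \<longrightarrow> of_rat a < w n z"
      "w n ((h ^^ m) z) < of_rat d"
      "(\<exists>y\<in>cylinder l. \<forall>i. of_rat c < w i y) \<longrightarrow> of_rat c < w n ((h ^^ m) z)"
      by blast
    \<comment> \<open>The centre \<open>x\<close> of the neighbourhood is the witness that activates
      the lower bound.\<close>
    have "\<bar>phi z - t\<bar> < r" using ab(2)[OF z(5)] z(6) k(2) phi_on_L[OF z(1)] by auto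
    moreover have "\<bar>phi ((h ^^ m) z) - s\<bar> < r'"
      using cd(2)[OF z(7)] z(8) l(2) phi_on_L[OF z(3)] by auto
    ultimately have "(z, phi z) \<in> U" "((h ^^ m) z, phi ((h ^^ m) z)) \<in> V"
      using k(3)[OF z(2)] l(3)[OF z(4)] by (auto simp: mem_F phi_nonneg)
    then show "\<exists>z. 0 < phi z \<and> (z, phi z) \<in> U \<and> ((h ^^ m) z, phi ((h ^^ m) z)) \<in> V"
      using phi_on_L[OF z(1)] by (intro exI[of _ z]) simp
  qed
qed

lemma top_mixing_hh: "top_mixing_on F hh"
  unfolding top_mixing_on_def
proof (intro allI impI, elim conjE)
  fix U V assume UV: "openin (top_of_set F) U" "openin (top_of_set F) V" "U \<noteq> {}" "V \<noteq> {}"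
  obtain N where N: "\<And>m. m \<ge> N \<Longrightarrow>
      \<exists>z. 0 < phi z \<and> (z, phi z) \<in> U \<and> ((h ^^ m) z, phi ((h ^^ m) z)) \<in> V"
    by (rule graph_mixing[OF UV]) blast
  show "\<exists>N. \<forall>n\<ge>N. (hh ^^ n) ` U \<inter> V \<noteq> {}"
  proof (intro exI allI impI)
    fix m assume "N \<le> m"
    from N[OF this] obtain z where "(z, phi z) \<in> U" "(hh ^^ m) (z, phi z) \<in> V"
      by (auto simp: hh_pow_graph)
    then show "(hh ^^ m) ` U \<inter> V \<noteq> {}" by blast
  qed
qed

text \<open>This is \<open>graph_mixing\<close> from a set to itself at a single time, keeping only
  the starting point.\<close>

lemma graph_dense:
  assumes "open T" "F \<inter> T \<noteq> {}"
  obtains z where "0 < phi z" "(z, phi z) \<in> T"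
proof -
  have *: "openin (top_of_set F) (F \<inter> T)" using assms(1) by (rule openin_open_Int)
  obtain N where "\<And>m. m \<ge> N \<Longrightarrow> \<exists>z. 0 < phi z \<and> (z, phi z) \<in> F \<inter> T \<and>
      ((h ^^ m) z, phi ((h ^^ m) z)) \<in> F \<inter> T"
    using graph_mixing[OF * * assms(2,2)] by metis
  then show ?thesis using that by blast
qed

lemma lelek_fence_phi: "lelek_fence (\<lambda>_. 0) phi"
  unfolding lelek_fence_def
proof (intro conjI exI[of _ "{x. 0 < phi x}"])
  show "closure {x. 0 < phi x} = UNIV"
  proof -
    have "{x. 0 < phi x} \<inter> S \<noteq> {}" if S: "open S" "S \<noteq> {}" for S
    proof -
      obtain x where "x \<in> S" using S(2) by auto
      \<comment> \<open>The fence contains the whole base at height 0, so every open strip over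
        \<open>S\<close> meets it, and density of the graph yields a point of \<open>S\<close> with
        positive \<open>phi\<close>.\<close>
      then have "(x, 0) \<in> F \<inter> S \<times> UNIV" by (simp add: mem_F phi_nonneg)
      then show ?thesis
        using graph_dense[of "S \<times> UNIV"] \<open>open S\<close> by (auto simp: open_Times)
    qed
    then show ?thesis unfolding set_eq_iff closure_iff_nhds_not_empty by blast
  qed
  show "F \<subseteq> closure {(x, phi x) |x. True}"
  proof
    fix p assume p: "p \<in> F"
    show "p \<in> closure {(x, phi x) |x. True}"
      unfolding closure_iff_nhds_not_empty
    proof (intro allI impI)
      fix A S assume "S \<subseteq> A" "open S" "p \<in> S"
      then obtain z where "(z, phi z) \<in> S" using graph_dense[of S] p by blast
      then show "{(x, phi x) |x. True} \<inter> A \<noteq> {}" using \<open>S \<subseteq> A\<close> by blast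
    qed
  qed
qed auto

end

theorem theorem7p5:
  fixes h :: "cantor \<Rightarrow> cantor"
  assumes homeo: "\<exists>g. homeomorphism UNIV UNIV h g"
    and mixing: "top_mixing_on UNIV h"
    and K: "\<forall>U V. open U \<and> open V \<and> U \<noteq> {} \<and> V \<noteq> {} \<longrightarrow>
              (\<exists>K::cantor set. \<exists>m0::nat. compact K \<and> nowhere_dense K \<and> h ` K = K \<and>
                  (\<forall>m\<ge>m0. (h ^^ m) ` (K \<inter> U) \<inter> V \<noteq> {}))"
  shows "\<exists>phiL phiU hh. admissible phiL phiU \<and> lelek_fence phiL phiU \<and>
           lifting phiL phiU h hh \<and>
           (\<exists>g. homeomorphism (fence phiL phiU) (fence phiL phiU) hh g) \<and>
           top_mixing_on (fence phiL phiU) hh"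
proof -
  obtain g where g: "homeomorphism UNIV UNIV h g" using homeo ..
  interpret invertible_cantor_map h g
    using g by unfold_locales (auto simp: homeomorphism_def)
  obtain w L where "slow_tower h g w L"
    using refine_sequence K by meson
  then interpret slow_tower h g w L .
  have "admissible (\<lambda>_. 0) phi"
    by (simp add: admissible_def phi_nonneg phi_le_1 upper_semicont_phi lower_semicont_def)
  moreover have "lifting (\<lambda>_. 0) phi h hh"
    using hh_F by (simp add: lifting_def) (simp add: hh_def)
  ultimately show ?thesis
    using lelek_fence_phi homeomorphism_hh top_mixing_hh by blast
qed

end
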